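(* Let $n \ge 2$ and let $\mathcal{F} \subseteq \{-1,1\}^n$ be such that its Vapnik–Chervonenkis dimension $d = \mathrm{VC}(\mathcal{F})$ satisfies $1 \le d \le n/2$, and let $\gamma = \gamma_{\mathrm{orth}}(\mathcal{F})$. Then \[ |\mathcal{F}| \le 100 \cdot 2^{d\,\beta(\gamma)}, \] where $\beta(\gamma) = \dfrac{1}{H^{-1}\!\left[\log_2\!\big(2/(1+\gamma)\big)\right]}$.
   Context: For $x,y \in \{-1,1\}^n$ the inner product is $\langle x,y\rangle = \frac{1}{n}\sum_{i=1}^n x_i y_i$. For $\mathcal{F}\subseteq\{-1,1\}^n$ with at least two elements, $\gamma_{\mathrm{orth}}(\mathcal{F}) = \max\{|\langle x,y\rangle| : x \ne y \in \mathcal{F}\}$. For an index sequence $I=(i_1,\dots,i_k)$ of distinct elements of $\{1,\dots,n\}$, the projection is $\mathcal{F}|_I = \{(x_{i_1},\dots,x_{i_k}) : x\in\mathcal{F}\}$; $\mathcal{F}$ shatters $I$ if $\mathcal{F}|_I = \{-1,1\}^k$, and $\mathrm{VC}(\mathcal{F})$ is the largest $|I|$ over shattered $I$. $H(x) = -x\log_2 x - (1-x)\log_2(1-x)$ is the binary entropy function (with $H(0)=0$); it is increasing on $[0,1/2]$, and $H^{-1}:[0,1]\to[0,1/2]$ denotes its inverse on that interval. Thus $\beta:[0,1]\to[2,\infty]$ (with $\beta(1)=\infty$). *)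

theory Defs
  imports Complex_Main "HOL-Library.FuncSet" "HOL-Library.Extended_Real"
begin

text \<open>Points of \<open>{-1,1}\<^sup>n\<close> are extensional functions on the index set \<open>{1..n}\<close>, so that
  distinct functions are distinct points.\<close>

definition sign_cube :: "nat \<Rightarrow> (nat \<Rightarrow> real) set" where
  "sign_cube n = {1..n} \<rightarrow>\<^sub>E {-1, 1}"

definition cube_inner :: "nat \<Rightarrow> (nat \<Rightarrow> real) \<Rightarrow> (nat \<Rightarrow> real) \<Rightarrow> real" where
  "cube_inner n x y = (1 / real n) * (\<Sum>i=1..n. x i * y i)"

text \<open>Meaningful only for a finite \<open>F\<close> with at least two elements.\<close>

definition gamma_orth :: "nat \<Rightarrow> (nat \<Rightarrow> real) set \<Rightarrow> real" where
  "gamma_orth n F = Max {\<bar>cube_inner n x y\<bar> | x y. x \<in> F \<and> y \<in> F \<and> x \<noteq> y}"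

definition coord_proj :: "(nat \<Rightarrow> real) set \<Rightarrow> nat list \<Rightarrow> real list set" where
  "coord_proj F I = {map x I | x. x \<in> F}"

definition shatters :: "nat \<Rightarrow> (nat \<Rightarrow> real) set \<Rightarrow> nat list \<Rightarrow> bool" where
  "shatters n F I \<longleftrightarrow> distinct I \<and> set I \<subseteq> {1..n} \<and>
     coord_proj F I = {v. length v = length I \<and> set v \<subseteq> {-1, 1}}"

text \<open>The lengths are bounded by \<open>n\<close>, so the supremum is a maximum, except that the empty
  family, which shatters nothing, gets dimension \<open>0\<close>.\<close>

definition VC_dim :: "nat \<Rightarrow> (nat \<Rightarrow> real) set \<Rightarrow> nat" where
  "VC_dim n F = Sup {length I | I. shatters n F I}"

text \<open>The convention \<open>ln 0 = 0\<close> is harmless here: it gives the value \<open>0\<close> at \<open>0\<close> and \<open>1\<close>.\<close>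

definition binary_entropy :: "real \<Rightarrow> real" where
  "binary_entropy x = - x * log 2 x - (1 - x) * log 2 (1 - x)"

definition inv_binary_entropy :: "real \<Rightarrow> real" where
  "inv_binary_entropy = inv_into {0..1/2} binary_entropy"

text \<open>The division is that of the extended reals, where \<open>1 / 0 = \<infinity>\<close>; hence the value at
  \<open>1\<close> is \<open>\<infinity>\<close>.\<close>

definition beta_orth :: "real \<Rightarrow> ereal" where
  "beta_orth g = 1 / ereal (inv_binary_entropy (log 2 (2 / (1 + g))))"

definition two_powr :: "ereal \<Rightarrow> ereal" where
  "two_powr e = (if e = \<infinity> then \<infinity> else if e = -\<infinity> then 0 else ereal (2 powr real_of_ereal e))"

end

theory Submission
  imports Defs "HOL-Analysis.Convex" "HOL-Real_Asymp.Real_Asymp"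
begin

text \<open>
  Let \<open>p = H\<^sup>-\<^sup>1(log\<^sub>2(2/(1+\<gamma>)))\<close> and draw \<open>k = \<lceil>d/p\<rceil>\<close> coordinates independently. Two distinct points
  of \<open>F\<close> agree on all of them with probability at most \<open>\<alpha>\<^sup>k\<close>, where \<open>\<alpha> = (1+\<gamma>)/2 = 2\<^bsup>-H(p)\<^esup>\<close>, while by
  Sauer--Shelah the projection of \<open>F\<close> has at most \<open>S = \<Sum>\<^bsub>i\<le>d\<^esub> (k choose i)\<close> points. Counting colliding
  pairs with Cauchy--Schwarz gives \<open>1/S \<le> 1/|F| + \<alpha>\<^sup>k\<close>. The choice of \<open>k\<close> gives
  \<open>S \<alpha>\<^sup>k \<le> P(Bin(k,p) \<le> d) \<le> 11/12\<close>, the last step by a fourth moment argument, so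
  \<open>|F| \<le> 12 S \<le> 11 \<cdot> 2\<^sup>k \<le> 22 \<cdot> 2\<^bsup>d/p\<^esup>\<close>.
\<close>

section \<open>The Sauer--Shelah lemma\<close>

text \<open>Shattering in terms of traces of sets, to be matched with \<open>shatters\<close> on
  index lists later. The empty family shatters nothing, not even \<open>{}\<close>, which keeps the
  base case of the induction below true.\<close>

definition shattered_sets :: "'a set set \<Rightarrow> 'a set set" where
  "shattered_sets \<A> = {T. \<forall>U\<subseteq>T. \<exists>A\<in>\<A>. A \<inter> T = U}"

lemma shattered_sets_subset_Pow:
  assumes A: "\<A> \<subseteq> Pow V"
  shows "shattered_sets \<A> \<subseteq> Pow V"
proof
  fix T assume "T \<in> shattered_sets \<A>"
  then obtain A where "A \<in> \<A>" "A \<inter> T = T" unfolding shattered_sets_def by blast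
  then show "T \<in> Pow V" using A by blast
qed

text \<open>Pajor's strengthening of Sauer--Shelah, suited to induction on the ground set. Members
  without \<open>x\<close> form \<open>\<B>\<close>; those with \<open>x\<close>, once it is
  deleted, form \<open>\<C>\<close>. Sets shattered by \<open>\<B> \<union> \<C>\<close> are
  shattered by \<open>\<A>\<close>, those shattered by \<open>\<B> \<inter> \<C>\<close> are so with
  \<open>x\<close> added, and only the latter contain \<open>x\<close>.\<close>

lemma card_le_card_shattered_sets:
  assumes "finite V" "\<A> \<subseteq> Pow V"
  shows "card \<A> \<le> card (shattered_sets \<A>)"
  using assms
proof (induction V arbitrary: \<A> rule: finite_induct)
  case empty
  then have "\<A> = {} \<or> \<A> = {{}}" by (simp add: subset_singleton_iff)
  moreover have "shattered_sets {{}} = {{} :: 'a set}" by (auto simp: shattered_sets_def)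
  ultimately show ?case by (elim disjE) simp_all
next
  case (insert x V)
  define \<B> where "\<B> = {A \<in> \<A>. x \<notin> A}"
  define \<C> where "\<C> = (\<lambda>A. A - {x}) ` {A \<in> \<A>. x \<in> A}"
  have sub: "\<B> \<subseteq> Pow V" "\<C> \<subseteq> Pow V" using insert.prems unfolding \<B>_def \<C>_def by blast+
  have fin: "finite \<B>" "finite \<C>" "finite \<A>"
    using sub insert.prems finite_Pow_iff[of V] finite_Pow_iff[of "Set.insert x V"] insert.hyps(1)
    by (blast intro: finite_subset finite.insertI)+
  have inj: "inj_on (\<lambda>A. A - {x}) {A \<in> \<A>. x \<in> A}" by (rule inj_onI) auto
  have "card \<A> = card (\<B> \<union> {A \<in> \<A>. x \<in> A})" by (rule arg_cong[where f = card]) (auto simp: \<B>_def)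
  also have "\<dots> = card \<B> + card {A \<in> \<A>. x \<in> A}"
    using fin by (intro card_Un_disjoint) (auto simp: \<B>_def)
  also have "card {A \<in> \<A>. x \<in> A} = card \<C>" unfolding \<C>_def by (simp add: card_image inj)
  also have "card \<B> + card \<C> = card (\<B> \<union> \<C>) + card (\<B> \<inter> \<C>)" using fin by (intro card_Un_Int)
  also have "\<dots> \<le> card (shattered_sets (\<B> \<union> \<C>)) + card (shattered_sets (\<B> \<inter> \<C>))"
    using sub by (intro add_mono insert.IH) auto
  also have "card (shattered_sets (\<B> \<inter> \<C>)) = card (Set.insert x ` shattered_sets (\<B> \<inter> \<C>))"
  proof (rule card_image[symmetric], rule inj_onI)
    fix S T assume "S \<in> shattered_sets (\<B> \<inter> \<C>)" "T \<in> shattered_sets (\<B> \<inter> \<C>)"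
      and eq: "Set.insert x S = Set.insert x T"
    then have "S \<subseteq> V" "T \<subseteq> V" using shattered_sets_subset_Pow[of "\<B> \<inter> \<C>" V] sub by auto
    then have "x \<notin> S" "x \<notin> T" using insert.hyps(2) by auto
    then show "S = T" using eq by (simp add: insert_ident)
  qed
  also have "card (shattered_sets (\<B> \<union> \<C>)) + card (Set.insert x ` shattered_sets (\<B> \<inter> \<C>))
     = card (shattered_sets (\<B> \<union> \<C>) \<union> Set.insert x ` shattered_sets (\<B> \<inter> \<C>))"
  proof (rule card_Un_disjoint[symmetric])
    have s: "shattered_sets (\<B> \<union> \<C>) \<subseteq> Pow V" "shattered_sets (\<B> \<inter> \<C>) \<subseteq> Pow V"
      using shattered_sets_subset_Pow[of "\<B> \<union> \<C>" V] shattered_sets_subset_Pow[of "\<B> \<inter> \<C>" V] sub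
      by (simp_all add: le_infI1)
    show "finite (shattered_sets (\<B> \<union> \<C>))" "finite (Set.insert x ` shattered_sets (\<B> \<inter> \<C>))"
      using finite_subset[OF s(1)] finite_subset[OF s(2)] insert.hyps(1) by simp_all
    show "shattered_sets (\<B> \<union> \<C>) \<inter> Set.insert x ` shattered_sets (\<B> \<inter> \<C>) = {}"
      using s insert.hyps(2) by auto
  qed
  also have "\<dots> \<le> card (shattered_sets \<A>)"
  proof (rule card_mono)
    show "finite (shattered_sets \<A>)"
      using finite_subset[OF shattered_sets_subset_Pow[OF insert.prems]] insert.hyps(1) by simp
    have "T \<in> shattered_sets \<A>" if T: "T \<in> shattered_sets (\<B> \<union> \<C>)" for T
    proof -
      have x: "x \<notin> T" using T shattered_sets_subset_Pow[of "\<B> \<union> \<C>" V] sub insert.hyps(2) by auto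
      have "\<exists>A\<in>\<A>. A \<inter> T = U" if "U \<subseteq> T" for U
      proof -
        obtain B where B: "B \<in> \<B> \<union> \<C>" "B \<inter> T = U" using T \<open>U \<subseteq> T\<close> by (auto simp: shattered_sets_def)
        then show ?thesis using x by (auto simp: \<B>_def \<C>_def)
      qed
      then show ?thesis unfolding shattered_sets_def by blast
    qed
    moreover have "Set.insert x T \<in> shattered_sets \<A>" if T: "T \<in> shattered_sets (\<B> \<inter> \<C>)" for T
    proof -
      have x: "x \<notin> T" using T shattered_sets_subset_Pow[of "\<B> \<inter> \<C>" V] sub insert.hyps(2) by auto
      have "\<exists>A\<in>\<A>. A \<inter> Set.insert x T = U" if U: "U \<subseteq> Set.insert x T" for U
      proof -
        have "U - {x} \<subseteq> T" using U by auto
        \<comment> \<open>As \<open>B\<close> lies in both families, \<open>\<A>\<close> contains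
          \<open>B\<close> and also \<open>B\<close> with \<open>x\<close> added; whether
          \<open>x\<close> is in \<open>U\<close> decides which of them has trace
          \<open>U\<close>.\<close>
        then obtain B where B: "B \<in> \<B>" "B \<in> \<C>" "B \<inter> T = U - {x}"
          using T unfolding shattered_sets_def by blast
        obtain A where A: "A \<in> \<A>" "x \<in> A" "B = A - {x}" using B(2) by (auto simp: \<C>_def)
        show ?thesis
        proof (cases "x \<in> U")
          case True
          then have "A \<inter> Set.insert x T = U" using A B(3) by auto
          then show ?thesis using A by blast
        next
          case False
          then have "B \<inter> Set.insert x T = U" using A B(3) by auto
          then show ?thesis using B(1) by (auto simp: \<B>_def)
        qed
      qed
      then show ?thesis unfolding shattered_sets_def by blast
    qed
    ultimately show "shattered_sets (\<B> \<union> \<C>) \<union> Set.insert x ` shattered_sets (\<B> \<inter> \<C>) \<subseteq> shattered_sets \<A>"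
      by blast
  qed
  finally show ?case .
qed

lemma card_subsets_card_le:
  assumes "finite V"
  shows "card {T. T \<subseteq> V \<and> card T \<le> d} = (\<Sum>i\<le>d. card V choose i)"
proof -
  have "{T. T \<subseteq> V \<and> card T \<le> d} = (\<Union>i\<le>d. {T. T \<subseteq> V \<and> card T = i})" by auto
  also have "card \<dots> = (\<Sum>i\<le>d. card {T. T \<subseteq> V \<and> card T = i})"
    using assms by (intro card_UN_disjoint) auto
  finally show ?thesis using n_subsets[OF assms] by simp
qed

corollary sauer_shelah:
  assumes "finite V" "\<A> \<subseteq> Pow V" "\<And>T. T \<in> shattered_sets \<A> \<Longrightarrow> card T \<le> d"
  shows "card \<A> \<le> (\<Sum>i\<le>d. card V choose i)"
proof -
  have "shattered_sets \<A> \<subseteq> {T. T \<subseteq> V \<and> card T \<le> d}"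
    using shattered_sets_subset_Pow[OF assms(2)] assms(3) by auto
  then have "card (shattered_sets \<A>) \<le> card {T. T \<subseteq> V \<and> card T \<le> d}"
    using assms(1) by (intro card_mono) auto
  then show ?thesis
    using card_le_card_shattered_sets[OF assms(1,2)] card_subsets_card_le[OF assms(1)] by simp
qed

section \<open>Projections of a family of bounded dimension\<close>

lemma length_le_VC_dim:
  assumes "shatters n F I"
  shows "length I \<le> VC_dim n F"
proof -
  have "length J \<le> n" if "shatters n F J" for J
    using that card_mono[of "{1..n}" "set J"] by (auto simp: shatters_def distinct_card)
  then have "bdd_above {length I | I. shatters n F I}" by (auto simp: bdd_above_def)
  then show ?thesis unfolding VC_dim_def using assms by (intro cSup_upper) auto
qed

text \<open>A dimension of at least 1 rules out the empty set of lengths, whose supremum is 0; a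
  finite nonempty set of naturals contains its supremum.\<close>

lemma VC_dim_attained:
  assumes "VC_dim n F \<ge> 1"
  obtains I where "shatters n F I" "length I = VC_dim n F"
proof -
  let ?L = "{length I | I. shatters n F I}"
  have "length J \<le> n" if "shatters n F J" for J
    using that card_mono[of "{1..n}" "set J"] by (auto simp: shatters_def distinct_card)
  then have "finite ?L" by (auto intro: finite_subset[of _ "{..n}"])
  moreover have "?L \<noteq> {}"
  proof
    assume "?L = {}"
    with assms show False unfolding VC_dim_def by (simp add: Sup_nat_def)
  qed
  ultimately have "VC_dim n F \<in> ?L"
    using Max_in[of ?L] unfolding VC_dim_def Sup_nat_def by presburger
  then show thesis using that by auto
qed

lemma finite_sign_cube: "finite (sign_cube n)"
  unfolding sign_cube_def by (intro finite_PiE) auto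

lemma sign_cube_cases:
  assumes "F \<subseteq> sign_cube n" "x \<in> F" "i \<in> {1..n}"
  shows "x i = -1 \<or> x i = 1"
  using assms PiE_mem[of x "{1..n}" "\<lambda>_. {-1, 1}" i] unfolding sign_cube_def by blast

text \<open>Encode a point by the set \<open>pos\<close> of sampled coordinates where it is 1;
  \<open>g\<close> recovers the projection, so Sauer--Shelah on \<open>set J\<close> applies.
  \<open>J\<close> may repeat indices, as sampling is with repetition.\<close>

lemma card_projection_le:
  assumes F: "F \<subseteq> sign_cube n" and J: "set J \<subseteq> {1..n}"
  shows "card ((\<lambda>x. map x J) ` F) \<le> (\<Sum>i\<le>VC_dim n F. length J choose i)"
proof -
  define pos where "pos x = {i \<in> set J. x i = 1}" for x :: "nat \<Rightarrow> real"
  define g :: "nat set \<Rightarrow> real list" where "g A = map (\<lambda>i. if i \<in> A then 1 else -1) J" for A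
  have finF: "finite F" using F finite_sign_cube finite_subset by blast
  have "map x J = g (pos x)" if "x \<in> F" for x
  proof -
    have "x i = -1 \<or> x i = 1" if "i \<in> set J" for i
      using sign_cube_cases[OF F \<open>x \<in> F\<close>] that J by blast
    then show ?thesis by (auto simp: g_def pos_def)
  qed
  then have "(\<lambda>x. map x J) ` F = g ` (pos ` F)" by (simp add: image_image)
  then have "card ((\<lambda>x. map x J) ` F) \<le> card (pos ` F)" using finF by (simp add: card_image_le)
  also have "\<dots> \<le> (\<Sum>i\<le>VC_dim n F. card (set J) choose i)"
  proof (rule sauer_shelah)
    show "pos ` F \<subseteq> Pow (set J)" by (auto simp: pos_def)
    fix T assume T: "T \<in> shattered_sets (pos ` F)"
    have TJ: "T \<subseteq> set J" using shattered_sets_subset_Pow[OF \<open>pos ` F \<subseteq> Pow (set J)\<close>] T by auto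
    then have finT: "finite T" by (rule finite_subset) simp
    define I where "I = sorted_list_of_set T"
    have I: "distinct I" "set I = T" "length I = card T" using finT by (auto simp: I_def)
    have "shatters n F I"
      unfolding shatters_def coord_proj_def
    proof (intro conjI equalityI subsetI)
      show "distinct I" by fact
      show "i \<in> {1..n}" if "i \<in> set I" for i using that I TJ J by auto
      show "v \<in> {v. length v = length I \<and> set v \<subseteq> {-1, 1}}" if v: "v \<in> {map x I |x. x \<in> F}" for v
      proof -
        obtain x where x: "x \<in> F" "v = map x I" using v by auto
        have "x i \<in> {-1, 1}" if "i \<in> set I" for i
          using sign_cube_cases[OF F x(1)] that I(2) TJ J by blast
        then show ?thesis using x(2) by auto
      qed
      fix v :: "real list" assume v: "v \<in> {v. length v = length I \<and> set v \<subseteq> {-1, 1}}"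
      \<comment> \<open>\<open>U\<close> is the trace on \<open>T\<close> prescribed by the sign
        pattern \<open>v\<close>; a point with this trace projects to \<open>v\<close>.\<close>
      define U where "U = {I ! j |j. j < length I \<and> v ! j = 1}"
      have "U \<subseteq> T" using I(2) by (auto simp: U_def)
      then obtain x where x: "x \<in> F" "pos x \<inter> T = U" using T by (auto simp: shattered_sets_def)
      have "map x I = v"
      proof (rule nth_equalityI)
        show "length (map x I) = length v" using v by simp
        fix j assume "j < length (map x I)"
        then have j: "j < length I" "j < length v" using v by auto
        then have mem: "I ! j \<in> T" using I(2) by auto
        have "x (I ! j) = 1 \<longleftrightarrow> I ! j \<in> U" using x(2) mem TJ by (auto simp: pos_def)
        also have "\<dots> \<longleftrightarrow> v ! j = 1" using j I(1) by (auto simp: U_def nth_eq_iff_index_eq)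
        finally have "x (I ! j) = 1 \<longleftrightarrow> v ! j = 1" .
        moreover have "x (I ! j) = -1 \<or> x (I ! j) = 1"
          using sign_cube_cases[OF F x(1)] mem TJ J by blast
        moreover have "v ! j = -1 \<or> v ! j = 1" using v nth_mem[OF j(2)] by auto
        ultimately show "map x I ! j = v ! j" using j by auto
      qed
      then show "v \<in> {map x I |x. x \<in> F}" using x(1) by auto
    qed
    then show "card T \<le> VC_dim n F" using length_le_VC_dim I(3) by metis
  qed simp
  \<comment> \<open>Repetitions make \<open>card (set J)\<close> at most \<open>length J\<close>,
    and binomials grow with the upper argument.\<close>
  also have "\<dots> \<le> (\<Sum>i\<le>VC_dim n F. length J choose i)"
    by (intro sum_mono binomial_right_mono card_length)
  finally show ?thesis .
qed

section \<open>Counting collisions under random projections\<close>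

text \<open>Cauchy--Schwarz for the fibre sizes of \<open>g\<close>: they add up to
  \<open>card F\<close>, and their squares count the ordered colliding pairs, diagonal
  included.\<close>

lemma card_sq_le_card_image_times_collisions:
  assumes "finite F"
  shows "(real (card F))\<^sup>2 \<le> real (card (g ` F)) * (\<Sum>(x, y)\<in>F \<times> F. if g x = g y then 1 else 0)"
proof -
  let ?c = "\<lambda>v. \<Sum>x\<in>F. if g x = v then 1 else (0::real)"
  have "real (card F) = (\<Sum>x\<in>F. \<Sum>v\<in>g ` F. if g x = v then 1 else 0)"
    using assms by (simp add: sum.delta)
  also have "\<dots> = (\<Sum>v\<in>g ` F. ?c v)" by (rule sum.swap)
  finally have "(real (card F))\<^sup>2 \<le> (\<Sum>v\<in>g ` F. (?c v)\<^sup>2) * real (card (g ` F))"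
    using sum_squared_le_sum_of_squares[of ?c "g ` F"] by simp
  also have "(\<Sum>v\<in>g ` F. (?c v)\<^sup>2)
      = (\<Sum>v\<in>g ` F. \<Sum>x\<in>F. \<Sum>y\<in>F. (if g x = v then 1 else 0) * (if g y = v then 1 else 0))"
    by (simp only: power2_eq_square sum_product)
  also have "\<dots> = (\<Sum>x\<in>F. \<Sum>v\<in>g ` F. if g x = v then \<Sum>y\<in>F. (if g y = v then 1 else 0) else 0)"
    by (subst sum.swap) (auto intro!: sum.cong)
  also have "\<dots> = (\<Sum>x\<in>F. \<Sum>y\<in>F. if g x = g y then 1 else 0)"
    using assms by (auto simp: sum.delta' eq_commute intro!: sum.cong)
  also have "\<dots> = (\<Sum>(x, y)\<in>F \<times> F. if g x = g y then 1 else 0)"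
    by (simp add: sum.cartesian_product)
  finally show ?thesis by (simp add: mult.commute)
qed

text \<open>Averages the previous inequality over \<open>k\<close> coordinates drawn independently, with repetition.\<close>

lemma card_sq_le_by_sampling:
  fixes F :: "(nat \<Rightarrow> real) set"
  assumes F: "finite F" and n: "n \<ge> 1" and \<alpha>: "\<alpha> \<ge> 0"
    and agree: "\<And>x y. x \<in> F \<Longrightarrow> y \<in> F \<Longrightarrow> x \<noteq> y \<Longrightarrow> real (card {i \<in> {1..n}. x i = y i}) \<le> \<alpha> * real n"
    and proj: "\<And>J. set J \<subseteq> {1..n} \<Longrightarrow> length J = k \<Longrightarrow> real (card ((\<lambda>x. map x J) ` F)) \<le> S"
  shows "(real (card F))\<^sup>2 \<le> S * (real (card F) + (real (card F))\<^sup>2 * \<alpha> ^ k)"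
proof -
  let ?N = "real (card F)"
  let ?c = "\<lambda>J x y. if map x J = map y J then 1 else (0::real)"
  define L where "L = {J. set J \<subseteq> {1..n} \<and> length J = k}"
  have finL: "finite L" unfolding L_def by (rule finite_lists_length_eq) simp
  have cardL: "real (card L) = real n ^ k"
    unfolding L_def using card_lists_length_eq[of "{1..n}" k] by simp
  have S: "S \<ge> 0"
    using order_trans[OF of_nat_0_le_iff proj[of "replicate k 1"]] n by (simp add: set_replicate_conv_if)
  have pair: "(\<Sum>J\<in>L. ?c J x y) \<le> real n ^ k * ((if x = y then 1 else 0) + \<alpha> ^ k)"
    if "x \<in> F" "y \<in> F" for x y
  proof -
    let ?A = "{i \<in> {1..n}. x i = y i}"
    have "(\<Sum>J\<in>L. ?c J x y) = real (card {J \<in> L. map x J = map y J})"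
      using finL by (simp add: sum.If_cases Int_def)
    \<comment> \<open>Two points collide on \<open>J\<close> exactly when \<open>J\<close> is a word
      over their agreement set, so independent draws turn its size into a \<open>k\<close>-th
      power.\<close>
    also have "{J \<in> L. map x J = map y J} = {J. set J \<subseteq> ?A \<and> length J = k}"
      by (auto simp: L_def map_eq_conv)
    also have "real (card \<dots>) = real (card ?A) ^ k" by (subst card_lists_length_eq) auto
    also have "\<dots> \<le> real n ^ k * ((if x = y then 1 else 0) + \<alpha> ^ k)"
    proof (cases "x = y")
      case True
      then have "?A = {1..n}" by auto
      then have "real (card ?A) ^ k = real n ^ k * 1" by simp
      also have "\<dots> \<le> real n ^ k * (1 + \<alpha> ^ k)" using \<alpha> by (intro mult_left_mono) auto
      finally show ?thesis using True by simp
    next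
      case False
      then have "real (card ?A) ^ k \<le> (\<alpha> * real n) ^ k" using agree[OF that] by (intro power_mono) auto
      then show ?thesis using False by (simp add: power_mult_distrib mult.commute)
    qed
    finally show ?thesis .
  qed
  \<comment> \<open>The expectation is written as a sum over all \<open>n ^ k\<close> lists; this
    factor cancels at the end.\<close>
  have "real n ^ k * ?N\<^sup>2 = (\<Sum>J\<in>L. ?N\<^sup>2)" by (simp add: cardL)
  also have "\<dots> \<le> (\<Sum>J\<in>L. S * (\<Sum>(x, y)\<in>F \<times> F. ?c J x y))"
  proof (rule sum_mono)
    fix J assume "J \<in> L"
    then have "real (card ((\<lambda>x. map x J) ` F)) \<le> S" using proj by (auto simp: L_def)
    then have "real (card ((\<lambda>x. map x J) ` F)) * (\<Sum>(x, y)\<in>F \<times> F. ?c J x y) \<le> S * (\<Sum>(x, y)\<in>F \<times> F. ?c J x y)"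
      by (rule mult_right_mono) (auto intro!: sum_nonneg)
    then show "?N\<^sup>2 \<le> S * (\<Sum>(x, y)\<in>F \<times> F. ?c J x y)"
      using card_sq_le_card_image_times_collisions[OF F, of "\<lambda>x. map x J"] by linarith
  qed
  also have "\<dots> = S * (\<Sum>J\<in>L. \<Sum>x\<in>F. \<Sum>y\<in>F. ?c J x y)"
    by (simp only: sum_distrib_left[symmetric] sum.cartesian_product[where A = F and B = F])
  also have "(\<Sum>J\<in>L. \<Sum>x\<in>F. \<Sum>y\<in>F. ?c J x y) = (\<Sum>x\<in>F. \<Sum>J\<in>L. \<Sum>y\<in>F. ?c J x y)"
    by (rule sum.swap)
  also have "\<dots> = (\<Sum>x\<in>F. \<Sum>y\<in>F. \<Sum>J\<in>L. ?c J x y)"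
    by (rule sum.cong[OF refl], rule sum.swap)
  also have "S * \<dots> \<le> S * (\<Sum>x\<in>F. \<Sum>y\<in>F. real n ^ k * ((if x = y then 1 else 0) + \<alpha> ^ k))"
    using S by (intro mult_left_mono sum_mono pair) auto
  also have "\<dots> = real n ^ k * (S * (?N + ?N\<^sup>2 * \<alpha> ^ k))"
  proof -
    have "(\<Sum>y\<in>F. real n ^ k * ((if x = y then 1 else 0) + \<alpha> ^ k)) = real n ^ k * (1 + ?N * \<alpha> ^ k)"
      if "x \<in> F" for x
      using F that by (simp add: sum_distrib_left[symmetric] sum.distrib)
    then show ?thesis by (simp add: power2_eq_square algebra_simps)
  qed
  finally show ?thesis using n by simp
qed

section \<open>Inner products and agreements\<close>

lemma card_agreements_le:
  assumes F: "F \<subseteq> sign_cube n" and n: "n \<ge> 1" and xy: "x \<in> F" "y \<in> F" "x \<noteq> y"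
  shows "real (card {i \<in> {1..n}. x i = y i}) \<le> (1 + gamma_orth n F) / 2 * real n"
proof -
  let ?A = "{i \<in> {1..n}. x i = y i}"
  have "finite F" using F finite_sign_cube finite_subset by blast
  then have "finite ((\<lambda>(x, y). \<bar>cube_inner n x y\<bar>) ` (F \<times> F))" by simp
  then have "finite {\<bar>cube_inner n x y\<bar> | x y. x \<in> F \<and> y \<in> F \<and> x \<noteq> y}"
    by (rule finite_subset[rotated]) auto
  then have "\<bar>cube_inner n x y\<bar> \<le> gamma_orth n F"
    unfolding gamma_orth_def using xy by (intro Max_ge) auto
  then have le: "(\<Sum>i=1..n. x i * y i) \<le> gamma_orth n F * real n"
    using n by (simp add: cube_inner_def field_simps abs_le_iff)
  \<comment> \<open>A product of two signs is 1 on agreement and -1 otherwise, so the sum is twice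
    the number of agreements minus \<open>n\<close>.\<close>
  have "(\<Sum>i=1..n. x i * y i) = (\<Sum>i=1..n. 2 * (if x i = y i then 1 else 0) - 1)"
  proof (rule sum.cong)
    fix i assume "i \<in> {1..n}"
    then have "x i = -1 \<or> x i = 1" "y i = -1 \<or> y i = 1"
      using sign_cube_cases[OF F] xy by blast+
    then show "x i * y i = 2 * (if x i = y i then 1 else 0) - 1" by auto
  qed simp
  also have "\<dots> = 2 * real (card ?A) - real n"
    by (simp add: sum_subtractf sum_distrib_left[symmetric] sum.If_cases Int_def)
  finally show ?thesis using le by (simp add: field_simps)
qed

text \<open>Places \<open>log 2 (2 / (1 + \<gamma>))\<close> in the interval [0,1] on which the
  entropy can be inverted. A distinct pair makes the maximum range over a nonempty set, hence
  attained.\<close>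

lemma gamma_orth_bounds:
  assumes F: "F \<subseteq> sign_cube n" and xy: "x \<in> F" "y \<in> F" "x \<noteq> y"
  shows "0 \<le> gamma_orth n F" "gamma_orth n F \<le> 1"
proof -
  let ?G = "{\<bar>cube_inner n x y\<bar> | x y. x \<in> F \<and> y \<in> F \<and> x \<noteq> y}"
  have "finite F" using F finite_sign_cube finite_subset by blast
  then have "finite ((\<lambda>(x, y). \<bar>cube_inner n x y\<bar>) ` (F \<times> F))" by simp
  then have "finite ?G" by (rule finite_subset[rotated]) auto
  moreover have "?G \<noteq> {}" using xy by blast
  ultimately have "gamma_orth n F \<in> ?G" unfolding gamma_orth_def by (rule Max_in)
  then obtain u v where uv: "u \<in> F" "v \<in> F" "gamma_orth n F = \<bar>cube_inner n u v\<bar>" by auto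
  have "\<bar>\<Sum>i=1..n. u i * v i\<bar> \<le> (\<Sum>i=1..n. \<bar>u i * v i\<bar>)" by (rule sum_abs)
  also have "\<dots> = (\<Sum>i=1..n. 1)"
  proof (rule sum.cong)
    fix i assume "i \<in> {1..n}"
    then have "u i = -1 \<or> u i = 1" "v i = -1 \<or> v i = 1"
      using sign_cube_cases[OF F] uv by blast+
    then show "\<bar>u i * v i\<bar> = 1" by auto
  qed simp
  finally have "\<bar>\<Sum>i=1..n. u i * v i\<bar> \<le> real n" by simp
  then have "\<bar>\<Sum>i=1..n. u i * v i\<bar> / real n \<le> 1" by (cases "n = 0") (auto simp: field_simps)
  then show "gamma_orth n F \<le> 1" using uv by (simp add: cube_inner_def abs_mult)
  show "0 \<le> gamma_orth n F" using uv by simp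
qed

section \<open>The binomial distribution exceeds its mean with constant probability\<close>

text \<open>The expectation of \<open>f\<close> under Bin(k,p) as a finite sum, so that moments
  follow from a recursion in \<open>k\<close>.\<close>

definition binom_expect :: "nat \<Rightarrow> real \<Rightarrow> (nat \<Rightarrow> real) \<Rightarrow> real" where
  "binom_expect k p f = (\<Sum>i\<le>k. real (k choose i) * p ^ i * (1 - p) ^ (k - i) * f i)"

lemma binom_expect_0: "binom_expect 0 p f = f 0"
  by (simp add: binom_expect_def)

text \<open>Conditioning on one trial, which is Pascal's rule for the weights.\<close>

lemma binom_expect_Suc:
  "binom_expect (Suc k) p f = p * binom_expect k p (\<lambda>i. f (Suc i)) + (1 - p) * binom_expect k p f"
proof -
  let ?q = "1 - p"
  let ?g = "\<lambda>i. real (k choose i) * p ^ i * ?q ^ (Suc k - i) * f i"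
  have "binom_expect (Suc k) p f = ?q ^ Suc k * f 0
      + (\<Sum>i\<le>k. (real (k choose i) + real (k choose Suc i)) * p ^ Suc i * ?q ^ (k - i) * f (Suc i))"
    unfolding binom_expect_def by (subst sum.atMost_Suc_shift) simp
  also have "(\<Sum>i\<le>k. (real (k choose i) + real (k choose Suc i)) * p ^ Suc i * ?q ^ (k - i) * f (Suc i))
      = p * binom_expect k p (\<lambda>i. f (Suc i)) + (\<Sum>i\<le>k. ?g (Suc i))"
    by (simp add: binom_expect_def sum_distrib_left sum.distrib algebra_simps)
  also have "?q ^ Suc k * f 0 + (p * binom_expect k p (\<lambda>i. f (Suc i)) + (\<Sum>i\<le>k. ?g (Suc i)))
      = p * binom_expect k p (\<lambda>i. f (Suc i)) + (\<Sum>i\<le>Suc k. ?g i)"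
    by (subst sum.atMost_Suc_shift) simp
  \<comment> \<open>The extra term \<open>i = Suc k\<close> vanishes because its binomial
    coefficient is 0.\<close>
  also have "(\<Sum>i\<le>Suc k. ?g i) = ?q * binom_expect k p f"
    by (simp add: binom_expect_def sum_distrib_left binomial_eq_0)
      (auto simp: Suc_diff_le intro!: sum.cong)
  finally show ?thesis .
qed

lemma binom_expect_add: "binom_expect k p (\<lambda>i. f i + g i) = binom_expect k p f + binom_expect k p g"
  by (simp add: binom_expect_def sum.distrib distrib_left)

lemma binom_expect_cmult: "binom_expect k p (\<lambda>i. c * f i) = c * binom_expect k p f"
  by (simp add: binom_expect_def sum_distrib_left mult_ac)

lemma binom_expect_mono:
  assumes "0 \<le> p" "p \<le> 1" "\<And>i. f i \<le> g i"
  shows "binom_expect k p f \<le> binom_expect k p g"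
  unfolding binom_expect_def using assms by (intro sum_mono mult_left_mono) auto

lemma binom_expect_const: "binom_expect k p (\<lambda>_. c) = c"
  by (induction k) (auto simp: binom_expect_0 binom_expect_Suc algebra_simps)

text \<open>All four moments go through one induction on \<open>k\<close>: a further trial moves the
  centred variable by \<open>1 - p\<close> or \<open>- p\<close>, and expanding the power
  (\<open>shift\<close>) involves only moments of the same or lower order.\<close>

lemma binom_central_moments:
  defines "M \<equiv> \<lambda>k p m. binom_expect k p (\<lambda>i. (real i - real k * p) ^ m)"
  shows "M k p 1 = 0" "M k p 2 = real k * p * (1 - p)"
    "M k p 3 = real k * p * (1 - p) * (1 - 2 * p)"
    "M k p 4 = 3 * (real k * p * (1 - p))\<^sup>2 + real k * p * (1 - p) * (1 - 6 * p * (1 - p))"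
proof -
  have lin: "binom_expect k p (\<lambda>i. a0 + a1 * f i + a2 * f i ^ 2 + a3 * f i ^ 3 + a4 * f i ^ 4)
     = a0 + a1 * binom_expect k p (\<lambda>i. f i ^ 1) + a2 * binom_expect k p (\<lambda>i. f i ^ 2)
       + a3 * binom_expect k p (\<lambda>i. f i ^ 3) + a4 * binom_expect k p (\<lambda>i. f i ^ 4)"
    for k a0 a1 a2 a3 a4 and f :: "nat \<Rightarrow> real"
    by (simp add: binom_expect_add binom_expect_cmult binom_expect_const)
  have shift: "binom_expect k p (\<lambda>i. (real i - real k * p + c) ^ 1) = M k p 1 + c"
    "binom_expect k p (\<lambda>i. (real i - real k * p + c) ^ 2) = M k p 2 + 2 * c * M k p 1 + c ^ 2"
    "binom_expect k p (\<lambda>i. (real i - real k * p + c) ^ 3)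
      = M k p 3 + 3 * c * M k p 2 + 3 * c ^ 2 * M k p 1 + c ^ 3"
    "binom_expect k p (\<lambda>i. (real i - real k * p + c) ^ 4)
      = M k p 4 + 4 * c * M k p 3 + 6 * c ^ 2 * M k p 2 + 4 * c ^ 3 * M k p 1 + c ^ 4" for k c
    using lin[of k c 1 "\<lambda>i. real i - real k * p" 0 0 0]
      lin[of k "c ^ 2" "2 * c" "\<lambda>i. real i - real k * p" 1 0 0]
      lin[of k "c ^ 3" "3 * c ^ 2" "\<lambda>i. real i - real k * p" "3 * c" 1 0]
      lin[of k "c ^ 4" "4 * c ^ 3" "\<lambda>i. real i - real k * p" "6 * c ^ 2" "4 * c" 1]
    by (simp_all add: M_def power2_eq_square power3_eq_cube power4_eq_xxxx algebra_simps)
  have step: "M (Suc k) p m = p * binom_expect k p (\<lambda>i. (real i - real k * p + (1 - p)) ^ m)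
      + (1 - p) * binom_expect k p (\<lambda>i. (real i - real k * p + (- p)) ^ m)" for k m
    unfolding M_def by (subst binom_expect_Suc) (simp add: algebra_simps)
  have "M k p 1 = 0 \<and> M k p 2 = real k * p * (1 - p) \<and> M k p 3 = real k * p * (1 - p) * (1 - 2 * p)
    \<and> M k p 4 = 3 * (real k * p * (1 - p))\<^sup>2 + real k * p * (1 - p) * (1 - 6 * p * (1 - p))"
  proof (induction k)
    case 0
    show ?case by (simp add: M_def binom_expect_0)
  next
    case (Suc k)
    then have IH: "M k p 1 = 0" "M k p 2 = real k * p * (1 - p)"
      "M k p 3 = real k * p * (1 - p) * (1 - 2 * p)"
      "M k p 4 = 3 * (real k * p * (1 - p))\<^sup>2 + real k * p * (1 - p) * (1 - 6 * p * (1 - p))"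
      by blast+
    have 1: "M (Suc k) p 1 = 0" unfolding step shift IH by (simp add: algebra_simps)
    have 2: "M (Suc k) p 2 = real (Suc k) * p * (1 - p)"
      unfolding step shift IH by (simp add: power2_eq_square algebra_simps)
    have 3: "M (Suc k) p 3 = real (Suc k) * p * (1 - p) * (1 - 2 * p)"
      unfolding step shift IH by (simp add: power2_eq_square power3_eq_cube algebra_simps)
    have 4: "M (Suc k) p 4 = 3 * (real (Suc k) * p * (1 - p))\<^sup>2 + real (Suc k) * p * (1 - p) * (1 - 6 * p * (1 - p))"
      unfolding step shift IH
      by (simp add: power2_eq_square power3_eq_cube power4_eq_xxxx algebra_simps)
    show ?case using 1 2 3 4 by blast
  qed
  then show "M k p 1 = 0" "M k p 2 = real k * p * (1 - p)"
    "M k p 3 = real k * p * (1 - p) * (1 - 2 * p)"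
    "M k p 4 = 3 * (real k * p * (1 - p))\<^sup>2 + real k * p * (1 - p) * (1 - 6 * p * (1 - p))"
    by auto
qed

text \<open>A quartic minorant of a multiple of the indicator of \<open>z > 0\<close>. Its linear
  term has mean 0 for a centred variable and makes it factor as
  \<open>z * (4 - z) * (z + 2)\<^sup>2\<close>, which is nonpositive for
  \<open>z \<le> 0\<close>.\<close>

lemma quartic_le_indicator:
  fixes z :: real
  shows "16 * z + 12 * z\<^sup>2 - z ^ 4 \<le> (if z > 0 then 84 else 0)"
proof (cases "z > 0")
  case True
  have "84 - (16 * z + 12 * z\<^sup>2 - z ^ 4) = (z\<^sup>2 - 8)\<^sup>2 + 4 * (z - 2)\<^sup>2 + 4"
    by (simp add: power2_eq_square power4_eq_xxxx algebra_simps)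
  moreover have "0 \<le> (z\<^sup>2 - 8)\<^sup>2 + 4 * (z - 2)\<^sup>2" by simp
  ultimately have "16 * z + 12 * z\<^sup>2 - z ^ 4 \<le> 84" by linarith
  then show ?thesis using True by simp
next
  case False
  have "16 * z + 12 * z\<^sup>2 - z ^ 4 = - (- z * (4 - z) * (z + 2)\<^sup>2)"
    by (simp add: power2_eq_square power4_eq_xxxx algebra_simps)
  moreover have "- z * (4 - z) * (z + 2)\<^sup>2 \<ge> 0" using False by (intro mult_nonneg_nonneg) auto
  ultimately show ?thesis using False by simp
qed

text \<open>Take the expectation of the quartic at the standardised variable. Variance 1 and fourth
  moment at most 5 give at least 12 - 5 = 7, and 7/84 = 1/12.\<close>

lemma binom_exceeds_mean:
  assumes p: "0 \<le> p" "p \<le> 1" and var: "real k * p * (1 - p) \<ge> 1 / 2"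
  shows "binom_expect k p (\<lambda>i. if real i > real k * p then 1 else 0) \<ge> 1 / 12"
proof -
  define v where "v = real k * p * (1 - p)"
  define s where "s = sqrt v"
  have v: "v \<ge> 1 / 2" using var by (simp add: v_def)
  have s: "s > 0" "s\<^sup>2 = v" using v by (auto simp: s_def)
  have s4: "s ^ 4 = v\<^sup>2" using s(2) by (metis power_mult numeral_times_numeral semiring_norm(12,13))
  let ?f = "\<lambda>i. real i - real k * p"
  have M: "binom_expect k p (\<lambda>i. ?f i ^ 1) = 0" "binom_expect k p (\<lambda>i. ?f i ^ 2) = v"
    "binom_expect k p (\<lambda>i. ?f i ^ 4) = 3 * v\<^sup>2 + v * (1 - 6 * p * (1 - p))"
    using binom_central_moments[of k p] by (simp_all add: v_def)
  have "v * (1 - 6 * p * (1 - p)) \<le> v * 1" using p v by (intro mult_left_mono) auto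
  \<comment> \<open>Here \<open>v \<ge> 1 / 2\<close> enters: it absorbs the lower-order term of the
    fourth moment into \<open>2 * v\<^sup>2\<close>.\<close>
  also have "v * 1 \<le> v * (2 * v)" using v by (intro mult_left_mono) auto
  finally have M4: "binom_expect k p (\<lambda>i. ?f i ^ 4) \<le> 5 * v\<^sup>2"
    using M(3) by (simp add: power2_eq_square)
  have "7 \<le> 12 - binom_expect k p (\<lambda>i. ?f i ^ 4) / v\<^sup>2"
    using M4 v by (simp add: field_simps)
  also have "\<dots> = (16 / s) * binom_expect k p (\<lambda>i. ?f i ^ 1) + (12 / v) * binom_expect k p (\<lambda>i. ?f i ^ 2)
      + (- 1 / v\<^sup>2) * binom_expect k p (\<lambda>i. ?f i ^ 4)"
    using M(1,2) v by simp
  also have "\<dots> = binom_expect k p (\<lambda>i. (16 / s) * ?f i ^ 1 + (12 / v) * ?f i ^ 2 + (- 1 / v\<^sup>2) * ?f i ^ 4)"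
    by (simp only: binom_expect_add binom_expect_cmult)
  also have "\<dots> \<le> binom_expect k p (\<lambda>i. 84 * (if real i > real k * p then 1 else 0))"
  proof (rule binom_expect_mono[OF p])
    fix i
    have "(16 / s) * ?f i ^ 1 + (12 / v) * ?f i ^ 2 + (- 1 / v\<^sup>2) * ?f i ^ 4
        = 16 * (?f i / s) + 12 * (?f i / s)\<^sup>2 - (?f i / s) ^ 4"
      by (simp add: power_divide s(2) s4)
    also have "\<dots> \<le> (if ?f i / s > 0 then 84 else 0)" by (rule quartic_le_indicator)
    also have "\<dots> = 84 * (if real i > real k * p then 1 else 0)"
      using s(1) by (simp add: zero_less_divide_iff)
    finally show "(16 / s) * ?f i ^ 1 + (12 / v) * ?f i ^ 2 + (- 1 / v\<^sup>2) * ?f i ^ 4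
      \<le> 84 * (if real i > real k * p then 1 else 0)" .
  qed
  also have "\<dots> = 84 * binom_expect k p (\<lambda>i. if real i > real k * p then 1 else 0)"
    by (rule binom_expect_cmult)
  finally show ?thesis by simp
qed

text \<open>Exponential tilting of the partial binomial sum; the constant \<open>11/12\<close>, which the entropy bound
  \<open>2\<^bsup>k H(d/k)\<^esup>\<close> lacks, is what makes the collision count effective.\<close>

lemma partial_binomial_sum_le:
  assumes p: "0 < p" "p \<le> 1 / 2" and d: "1 \<le> d" "real d \<le> real k * p"
  shows "(\<Sum>i\<le>d. real (k choose i)) * (p ^ d * (1 - p) ^ (k - d)) \<le> 11 / 12"
proof -
  have "real k * p \<le> real k * 1" using p by (intro mult_left_mono) auto
  then have dk: "d \<le> k" using d(2) by simp
  \<comment> \<open>Since \<open>p \<le> 1 - p\<close>, turning \<open>d - i\<close> factors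
    \<open>p\<close> into \<open>1 - p\<close> can only increase the weight.\<close>
  have tilt: "p ^ d * (1 - p) ^ (k - d) \<le> p ^ i * (1 - p) ^ (k - i)" if "i \<le> d" for i
  proof -
    have "p ^ d * (1 - p) ^ (k - d) = p ^ i * (p ^ (d - i) * (1 - p) ^ (k - d))"
      using that by (simp flip: power_add add: mult.assoc[symmetric])
    also have "\<dots> \<le> p ^ i * ((1 - p) ^ (d - i) * (1 - p) ^ (k - d))"
      using p by (intro mult_left_mono mult_right_mono power_mono) auto
    also have "\<dots> = p ^ i * (1 - p) ^ (k - i)" using that dk by (simp flip: power_add)
    finally show ?thesis .
  qed
  have "real k * p * (1 - p) \<ge> 1 * (1 / 2)" using p d by (intro mult_mono) auto
  then have tail: "binom_expect k p (\<lambda>i. if real i > real k * p then 1 else 0) \<ge> 1 / 12"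
    using p by (intro binom_exceeds_mean) auto
  have "(\<Sum>i\<le>d. real (k choose i)) * (p ^ d * (1 - p) ^ (k - d))
      \<le> (\<Sum>i\<le>d. real (k choose i) * (p ^ i * (1 - p) ^ (k - i)))"
    unfolding sum_distrib_right by (intro sum_mono mult_left_mono tilt) auto
  also have "\<dots> = (\<Sum>i\<le>k. real (k choose i) * p ^ i * (1 - p) ^ (k - i) * (if i \<le> d then 1 else 0))"
    using dk by (intro sum.mono_neutral_cong_left) auto
  \<comment> \<open>As \<open>d \<le> k * p\<close>, the events \<open>i \<le> d\<close> and
    \<open>i > k * p\<close> are disjoint.\<close>
  also have "\<dots> \<le> binom_expect k p (\<lambda>i. 1 + (- 1) * (if real i > real k * p then 1 else 0))"
    unfolding binom_expect_def using p d(2) by (intro sum_mono mult_left_mono) auto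
  also have "\<dots> = 1 + (- 1) * binom_expect k p (\<lambda>i. if real i > real k * p then 1 else 0)"
    by (simp only: binom_expect_add binom_expect_cmult binom_expect_const)
  also have "\<dots> \<le> 11 / 12" using tail by simp
  finally show ?thesis .
qed

section \<open>The entropy function and the conclusion\<close>

text \<open>Intermediate value theorem between the values 0 at 0 and 1 at 1/2. It makes the
  \<open>inv_into\<close> in \<open>inv_binary_entropy\<close> a genuine preimage. The delicate
  point is continuity at 0, where \<open>x * log 2 x\<close> tends to 0.\<close>

lemma binary_entropy_surj:
  assumes "0 \<le> y" "y \<le> 1"
  shows "y \<in> binary_entropy ` {0..1 / 2}"
proof -
  have "((\<lambda>x. - x * log 2 x) \<longlongrightarrow> 0) (at_right (0::real))" by real_asymp
  then have "continuous (at_right 0) (\<lambda>x::real. - x * log 2 x)"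
    by (simp add: continuous_within)
  then have "continuous (at x within {0..1 / 2}) (\<lambda>x::real. - x * log 2 x)" if "x \<in> {0..1 / 2}" for x
  proof (cases "x = 0")
    case True
    then show ?thesis
      using \<open>continuous (at_right 0) (\<lambda>x::real. - x * log 2 x)\<close> at_within_Icc_at_right[of 0 "1 / 2 :: real"]
      by simp
  next
    case False
    then show ?thesis using that by (auto intro!: continuous_intros)
  qed
  then have "continuous_on {0..1 / 2} (\<lambda>x::real. - x * log 2 x)"
    by (auto simp: continuous_on_eq_continuous_within)
  moreover have "continuous_on {0..1 / 2} (\<lambda>x::real. (1 - x) * log 2 (1 - x))"
    by (auto intro!: continuous_intros)
  ultimately have cont: "continuous_on {0..1 / 2} binary_entropy"
    unfolding binary_entropy_def by (intro continuous_on_diff)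
  have "binary_entropy 0 = 0" "binary_entropy (1 / 2) = 1"
    by (auto simp: binary_entropy_def log_divide)
  then show ?thesis
    using IVT'[of binary_entropy 0 y "1 / 2", OF _ _ _ cont] assms by auto
qed

lemma binary_entropy_pos:
  assumes "0 < p" "p < 1"
  shows "0 < binary_entropy p"
proof -
  have "p * log 2 p < 0" "(1 - p) * log 2 (1 - p) < 0" using assms by (auto intro: mult_pos_neg)
  then show ?thesis by (simp add: binary_entropy_def)
qed

lemma two_powr_neg_entropy:
  assumes "0 < p" "p < 1"
  shows "2 powr (- binary_entropy p) = p powr p * (1 - p) powr (1 - p)"
proof -
  have "2 powr (- binary_entropy p) = 2 powr (log 2 p * p) * 2 powr (log 2 (1 - p) * (1 - p))"
    by (simp add: binary_entropy_def mult.commute add.commute flip: powr_add)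
  then show ?thesis using assms by (simp add: powr_powr[symmetric])
qed

text \<open>By the definition of entropy, \<open>\<alpha> ^ k\<close> is \<open>p\<close> to the
  power \<open>k * p\<close> times \<open>1 - p\<close> to the power \<open>k * (1 - p)\<close>.
  Moving the surplus exponent \<open>k * p - d\<close> from \<open>p\<close> to the larger base
  \<open>1 - p\<close> increases the product.\<close>

lemma entropy_power_le:
  assumes p: "0 < p" "p \<le> 1 / 2" and \<alpha>: "\<alpha> = 2 powr (- binary_entropy p)"
    and d: "real d \<le> real k * p"
  shows "\<alpha> ^ k \<le> p ^ d * (1 - p) ^ (k - d)"
proof -
  let ?e = "real k * p - real d"
  have "real k * p \<le> real k * 1" using p by (intro mult_left_mono) auto
  then have dk: "d \<le> k" using d by simp
  have "\<alpha> ^ k = \<alpha> powr real k" using \<alpha> by (simp add: powr_realpow)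
  also have "\<dots> = p powr (real k * p) * (1 - p) powr (real k * (1 - p))"
    using p by (simp add: \<alpha> two_powr_neg_entropy powr_mult powr_powr mult.commute)
  also have "p powr (real k * p) = p powr real d * p powr ?e" by (simp flip: powr_add)
  also have "p powr real d * p powr ?e * (1 - p) powr (real k * (1 - p))
      \<le> p powr real d * (1 - p) powr ?e * (1 - p) powr (real k * (1 - p))"
    using p d by (intro mult_left_mono mult_right_mono powr_mono2) auto
  also have "\<dots> = p powr real d * (1 - p) powr (real k - real d)"
    by (simp add: algebra_simps flip: powr_add)
  also have "\<dots> = p ^ d * (1 - p) ^ (k - d)"
    using p dk by (simp add: powr_realpow flip: of_nat_diff)
  finally show ?thesis .
qed

section \<open>The cardinality bound\<close>

lemma card_le_two_powr:
  assumes n: "n \<ge> 1" and F: "F \<subseteq> sign_cube n" "F \<noteq> {}"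
    and d: "1 \<le> VC_dim n F"
    and p: "0 < p" "p \<le> 1 / 2" and \<gamma>: "0 \<le> gamma_orth n F" "gamma_orth n F < 1"
    and ent: "binary_entropy p = log 2 (2 / (1 + gamma_orth n F))"
  shows "real (card F) \<le> 22 * 2 powr (real (VC_dim n F) / p)"
proof -
  define d where "d = VC_dim n F"
  define \<alpha> where "\<alpha> = (1 + gamma_orth n F) / 2"
  \<comment> \<open>The least sample size with \<open>d \<le> k * p\<close>; rounding up costs at
    most one further factor 2, which turns 11 into 22 at the end.\<close>
  define k where "k = nat \<lceil>real d / p\<rceil>"
  define S where "S = (\<Sum>i\<le>d. real (k choose i))"
  define N where "N = real (card F)"
  have finF: "finite F" using F finite_sign_cube finite_subset by blast
  then have N: "N > 0" using F by (simp add: N_def card_gt_0_iff)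
  have k: "real d / p \<le> real k" "real k \<le> real d / p + 1"
    using p by (auto simp: k_def)
  have dk: "real d \<le> real k * p" using k(1) p by (simp add: field_simps)
  have \<alpha>: "\<alpha> = 2 powr (- binary_entropy p)"
    using \<gamma> by (simp add: ent \<alpha>_def powr_minus)
  have \<alpha>_bounds: "1 / 2 \<le> \<alpha>" using \<gamma> by (simp add: \<alpha>_def)
  have "S \<ge> real (k choose 0)" unfolding S_def by (rule member_le_sum) auto
  then have S: "S > 0" by simp
  have "S * \<alpha> ^ k \<le> S * (p ^ d * (1 - p) ^ (k - d))"
    using S p dk by (intro mult_left_mono entropy_power_le \<alpha>) auto
  also have "\<dots> \<le> 11 / 12"
    unfolding S_def using p d dk by (intro partial_binomial_sum_le) (auto simp: d_def)
  finally have S\<alpha>: "S * \<alpha> ^ k \<le> 11 / 12" .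
  have "N\<^sup>2 \<le> S * (N + N\<^sup>2 * \<alpha> ^ k)"
    unfolding N_def
  proof (rule card_sq_le_by_sampling[OF finF n])
    show "\<alpha> \<ge> 0" using \<alpha>_bounds by simp
    show "real (card {i \<in> {1..n}. x i = y i}) \<le> \<alpha> * real n" if "x \<in> F" "y \<in> F" "x \<noteq> y" for x y
      unfolding \<alpha>_def using card_agreements_le[OF F(1) n that] .
    show "real (card ((\<lambda>x. map x J) ` F)) \<le> S" if "set J \<subseteq> {1..n}" "length J = k" for J
      using of_nat_mono[OF card_projection_le[OF F(1) that(1)], where 'a = real] that(2)
      by (simp add: S_def d_def)
  qed
  \<comment> \<open>After division by \<open>N\<close>, the collision term is at most
    \<open>11 / 12 * N\<close> and moves to the left, leaving \<open>N / 12 \<le> S\<close>.\<close>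
  then have "N * N \<le> N * (S + N * (S * \<alpha> ^ k))" by (simp add: power2_eq_square algebra_simps)
  then have "N \<le> S + N * (S * \<alpha> ^ k)" using N by simp
  also have "\<dots> \<le> S + N * (11 / 12)" using S\<alpha> N by (intro add_left_mono mult_left_mono) auto
  finally have "N \<le> 12 * S" by simp
  \<comment> \<open>The same estimate, with \<open>\<alpha> \<ge> 1 / 2\<close>, also bounds
    \<open>S\<close> itself by \<open>11 / 12 * 2 ^ k\<close>.\<close>
  moreover have "S * (1 / 2) ^ k \<le> 11 / 12"
    using S \<alpha>_bounds by (intro order_trans[OF _ S\<alpha>] mult_left_mono power_mono) auto
  ultimately have "N \<le> 11 * 2 ^ k" by (simp add: power_divide field_simps)
  also have "\<dots> = 11 * 2 powr real k" by (simp add: powr_realpow)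
  also have "\<dots> \<le> 11 * 2 powr (real d / p + 1)" using k by (intro mult_left_mono powr_mono) auto
  also have "\<dots> = 22 * 2 powr (real d / p)" by (simp add: powr_add)
  finally show ?thesis by (simp add: N_def d_def)
qed

text \<open>A shattered list of positive length has both constant sign patterns among its
  projections, and these differ.\<close>

lemma two_distinct_elements:
  assumes "1 \<le> VC_dim n F"
  obtains x y where "x \<in> F" "y \<in> F" "x \<noteq> y"
proof -
  obtain I where I: "shatters n F I" "length I = VC_dim n F" using VC_dim_attained[OF assms] .
  have "\<exists>x\<in>F. map x I = replicate (length I) c" if "c \<in> {-1, 1}" for c
  proof -
    have "replicate (length I) c \<in> coord_proj F I" using I(1) that by (auto simp: shatters_def)
    then show ?thesis by (auto simp: coord_proj_def)
  qed
  then obtain x y where "x \<in> F" "y \<in> F"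
      "map x I = replicate (length I) (-1)" "map y I = replicate (length I) 1"
    by (meson insertI1 insertI2)
  moreover from this have "x \<noteq> y" using I(2) assms by (auto simp: replicate_eq_replicate)
  ultimately show thesis using that by blast
qed

theorem theorem1:
  fixes n d :: nat and F :: "(nat \<Rightarrow> real) set" and \<gamma> :: real
  assumes "n \<ge> 2"
    and "F \<subseteq> sign_cube n"
    and "d = VC_dim n F"
    and "1 \<le> d" and "real d \<le> real n / 2"
    and "\<gamma> = gamma_orth n F"
  shows "ereal (real (card F)) \<le> 100 * two_powr (ereal (real d) * beta_orth \<gamma>)"
proof -
  obtain x y where xy: "x \<in> F" "y \<in> F" "x \<noteq> y"
    using two_distinct_elements assms(3,4) by metis
  have \<gamma>: "0 \<le> \<gamma>" "\<gamma> \<le> 1" using gamma_orth_bounds[OF assms(2) xy] assms(6) by auto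
  define p where "p = inv_binary_entropy (log 2 (2 / (1 + \<gamma>)))"
  have "log 2 (2 / (1 + \<gamma>)) \<le> log 2 2" using \<gamma> by (subst log_le_cancel_iff) (auto simp: field_simps)
  then have img: "log 2 (2 / (1 + \<gamma>)) \<in> binary_entropy ` {0..1 / 2}"
    using \<gamma> by (intro binary_entropy_surj) (auto simp: zero_le_log_cancel_iff)
  have p: "p \<in> {0..1 / 2}" unfolding p_def inv_binary_entropy_def using img by (rule inv_into_into)
  have ent: "binary_entropy p = log 2 (2 / (1 + \<gamma>))"
    unfolding p_def inv_binary_entropy_def using img by (rule f_inv_into_f)
  have \<beta>: "beta_orth \<gamma> = 1 / ereal p" by (simp add: beta_orth_def p_def)
  show ?thesis
  proof (cases "p = 0")
    case True
    then have "beta_orth \<gamma> = \<infinity>" using \<beta> by (simp add: divide_ereal_def)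
    \<comment> \<open>With \<open>d \<ge> 1\<close> the exponent is \<infinity>; for
      \<open>d = 0\<close> the product would be 0.\<close>
    then show ?thesis using assms(4) by (simp add: two_powr_def)
  next
    case False
    then have p0: "0 < p" "p \<le> 1 / 2" using p by auto
    \<comment> \<open>\<gamma> = 1 would force entropy \<open>log 2 1 = 0\<close> at a point
      \<open>p\<close> where it is positive.\<close>
    then have "\<gamma> \<noteq> 1" using ent binary_entropy_pos[of p] by auto
    then have "\<gamma> < 1" using \<gamma> by simp
    have "real (card F) \<le> 22 * 2 powr (real d / p)"
      using card_le_two_powr[of n F p] assms xy p0 \<gamma> \<open>\<gamma> < 1\<close> ent by auto
    also have "\<dots> \<le> 100 * 2 powr (real d / p)" by simp
    finally have "real (card F) \<le> 100 * 2 powr (real d / p)" .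
    moreover have "ereal (real d) * beta_orth \<gamma> = ereal (real d / p)"
      using p0 \<beta> by (simp add: divide_ereal_def) (simp add: field_simps)
    ultimately show ?thesis by (simp add: two_powr_def)
  qed
qed

end
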